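(* Let $\alpha$, $k_1$, $\phi$, $T$, $h$ and $\mathbb{Z}$ be as described in the context; in particular $0\le\phi(u)\le T^{-1}$ for all $u\in\mathbf{R}$. On a probability space $(\Omega,\mathcal{F},\mathrm{Prob})$, let $\omega\sim\mathbb{Z}$ be a path of the biased Brownian motion on $[0,T]$, let $(V_i,W_i)_{i\ge1}$ be a sequence of i.i.d. points uniformly distributed on $(0,T)\times(0,1/T)$, and let $U\sim\mathrm{Unif}(0,1)$; assume that $\omega$, $(V_i,W_i)_{i\ge1}$ and $U$ are independent. Define the events $\Gamma_0=\Omega$ and $$\Gamma_n=\Big\{\phi(B_{V_1}(\omega))\ge W_1,\ \ldots,\ \phi(B_{V_n}(\omega))\ge W_n,\ U\le\tfrac{1}{n!}\Big\},\qquad n=1,2,\ldots,$$ and the sequence of events $(E_n)_{n\ge1}$ by, for $n=0,1,\ldots$, $$E_{2n+1}=(\Gamma_0-\Gamma_1)+(\Gamma_2-\Gamma_3)+\cdots+(\Gamma_{2n}-\Gamma_{2n+1}),$$ $$E_{2n+2}=(\Gamma_0-\Gamma_1)+(\Gamma_2-\Gamma_3)+\cdots+(\Gamma_{2n}-\Gamma_{2n+1})+\Gamma_{2n+2},$$ where $+$ denotes union of disjoint sets and $D-F=D\cap F^c$ for $F\subseteq D$. Then: (i) $(E_{2n+1})_{n\ge0}$ is an increasing sequence of events and $(E_{2n+2})_{n\ge0}$ is a decreasing sequence of events, with $E_{2\kappa+1}\subseteq E_{2\lambda+2}$ for all $\kappa,\lambda\in\{0,1,\ldots\}$, and $\mathrm{Prob}\big[\bigcap_{n=0}^\infty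 E_{2n+2}-\bigcup_{n=0}^\infty E_{2n+1}\big]=0$. (ii) Let $E=\bigcup_{n=0}^\infty E_{2n+1}$ and let $I$ be the binary indicator with $I=1$ when $E$ occurs and $I=0$ otherwise. Then $$\mathrm{Prob}[I=1\mid\omega]=\exp\Big\{-\int_0^T\phi(B_t(\omega))\,dt\Big\}.$$
   Context: Drift: $\alpha:\mathbf{R}\to\mathbf{R}$ is such that the SDE $dX_t=\alpha(X_t)\,dt+dB_t$, $X_0=0$, has a global, weakly unique solution and Novikov's condition $\mathrm{E}_{\mathbb{W}}[\exp\{\frac12\int_0^T\alpha^2(B_t)\,dt\}]<\infty$ holds, with $\mathbb{W}$ the Wiener measure. Moreover: (1) $\alpha$ is everywhere differentiable; (2) with $A(u)=\int_0^u\alpha(y)\,dy$, one has $c:=\int_{\mathbf{R}}\exp\{A(u)-u^2/(2T)\}\,du<\infty$; (3) there are constants $k_1,k_2\in\mathbf{R}$ with $k_1\le\frac12\alpha^2(u)+\frac12\alpha'(u)\le k_2$ for all $u\in\mathbf{R}$. Define $\phi(u)=\frac12\alpha^2(u)+\frac12\alpha'(u)-k_1\ge0$. The length $T>0$ is fixed so that $0\le\phi(u)\le T^{-1}$ for all $u\in\mathbf{R}$ (for instance any $T\le1/(k_2-k_1)$). Path space: $C$ is the space of continuous functions $[0,T]\to\mathbf{R}$, $B_t(\omega)=\omega(t)$ are the coordinate functions, $\mathcal{C}=\sigma(\{B_t;0\le t\le T\})$. Biased Brownian motion: let $h(u)=\exp\{A(u)-u^2/(2T)\}/c$, a probability density on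 $\mathbf{R}$. $\mathbb{Z}$ is the law on $(C,\mathcal{C})$ of the process obtained by drawing $\rho\sim h$ and then, given $\rho$, taking a Brownian bridge on $[0,T]$ from $0$ at time $0$ to $\rho$ at time $T$. *)

theory Defs
  imports "HOL-Probability.Probability"
begin

section \<open>Path space, Brownian motion and Wiener measure\<close>

text \<open>Continuous paths indexed by \<open>I\<close>, with the \<open>\<sigma>\<close>-algebra generated by the coordinates. Paths are
  extensional, that is \<open>undefined\<close> off \<open>I\<close>. Only the measurable space matters here, not the measure.\<close>

definition path_space :: "real set \<Rightarrow> (real \<Rightarrow> real) measure" where
  "path_space I = restrict_space (Pi\<^sub>M I (\<lambda>_. borel)) {\<omega>. continuous_on I \<omega>}"

definition brownian_motion_on ::
    "real set \<Rightarrow> 'a measure \<Rightarrow> (real \<Rightarrow> 'a measure) \<Rightarrow> (real \<Rightarrow> 'a \<Rightarrow> real) \<Rightarrow> bool" where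
  "brownian_motion_on I M F B \<longleftrightarrow>
     prob_space M \<and>
     (\<forall>t\<in>I. subalgebra M (F t) \<and> B t \<in> borel_measurable (F t)) \<and>
     (\<forall>s\<in>I. \<forall>t\<in>I. s \<le> t \<longrightarrow> sets (F s) \<subseteq> sets (F t)) \<and>
     (AE \<omega> in M. B 0 \<omega> = 0) \<and>
     (\<forall>\<omega>\<in>space M. continuous_on I (\<lambda>t. B t \<omega>)) \<and>
     (\<forall>s\<in>I. \<forall>t\<in>I. s < t \<longrightarrow>
        distributed M lborel (\<lambda>\<omega>. B t \<omega> - B s \<omega>) (\<lambda>x. ennreal (normal_density 0 (sqrt (t - s)) x)) \<and>
        prob_space.indep_set M (sets (F s))
          (sets (vimage_algebra (space M) (\<lambda>\<omega>. B t \<omega> - B s \<omega>) borel)))"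

definition coordinate_filtration :: "'a measure \<Rightarrow> (real \<Rightarrow> 'a \<Rightarrow> real) \<Rightarrow> real \<Rightarrow> 'a measure" where
  "coordinate_filtration M X t =
     vimage_algebra (space M) (\<lambda>\<omega>. \<lambda>s\<in>{0..t}. X s \<omega>) (Pi\<^sub>M {0..t} (\<lambda>_. borel))"

definition wiener_measure :: "real \<Rightarrow> (real \<Rightarrow> real) measure \<Rightarrow> bool" where
  "wiener_measure T \<W> \<longleftrightarrow>
     sets \<W> = sets (path_space {0..T}) \<and>
     brownian_motion_on {0..T} \<W> (coordinate_filtration \<W> (\<lambda>t \<omega>. \<omega> t)) (\<lambda>t \<omega>. \<omega> t)"

section \<open>The stochastic differential equation\<close>

text \<open>Weak solutions, for all times \<open>t \<ge> 0\<close>, of \<open>dX = \<alpha>(X) dt + dB\<close> with \<open>X 0 = 0\<close>. As the noise is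
  additive, the integral form involves no stochastic integral.\<close>

definition weak_solution ::
    "(real \<Rightarrow> real) \<Rightarrow> 'a measure \<Rightarrow> (real \<Rightarrow> 'a measure) \<Rightarrow> (real \<Rightarrow> 'a \<Rightarrow> real) \<Rightarrow> (real \<Rightarrow> 'a \<Rightarrow> real) \<Rightarrow> bool" where
  "weak_solution \<alpha> M F X B \<longleftrightarrow>
     brownian_motion_on {0..} M F B \<and>
     (\<forall>t\<ge>0. X t \<in> borel_measurable (F t)) \<and>
     (\<forall>\<omega>\<in>space M. continuous_on {0..} (\<lambda>t. X t \<omega>)) \<and>
     (AE \<omega> in M. X 0 \<omega> = 0) \<and>
     (AE \<omega> in M. \<forall>t\<ge>0. set_integrable lborel {0..t} (\<lambda>s. \<alpha> (X s \<omega>)) \<and>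
        X t \<omega> = (LBINT s:{0..t}. \<alpha> (X s \<omega>)) + B t \<omega>)"

definition path_law :: "'a measure \<Rightarrow> (real \<Rightarrow> 'a \<Rightarrow> real) \<Rightarrow> (real \<Rightarrow> real) measure" where
  "path_law M X = distr M (path_space {0..}) (\<lambda>\<omega>. \<lambda>t\<in>{0..}. X t \<omega>)"

text \<open>HOL cannot quantify over sample space types inside a formula. Fixing the type of pairs of paths
  loses nothing: any weak solution is carried, by the map \<open>\<omega> \<mapsto> (X \<omega>, B \<omega>)\<close>, to one on that type
  with the same law, the filtration being the one generated by the two coordinate processes.\<close>

definition has_weakly_unique_global_solution :: "(real \<Rightarrow> real) \<Rightarrow> bool" where
  "has_weakly_unique_global_solution \<alpha> \<longleftrightarrow>
     (\<exists>(M :: ((real \<Rightarrow> real) \<times> (real \<Rightarrow> real)) measure) F X B. weak_solution \<alpha> M F X B) \<and>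
     (\<forall>(M :: ((real \<Rightarrow> real) \<times> (real \<Rightarrow> real)) measure) F X B
       (M' :: ((real \<Rightarrow> real) \<times> (real \<Rightarrow> real)) measure) F' X' B'.
        weak_solution \<alpha> M F X B \<longrightarrow> weak_solution \<alpha> M' F' X' B' \<longrightarrow> path_law M X = path_law M' X')"

section \<open>Biased Brownian motion\<close>

text \<open>The interval integral is signed, so this is the primitive of \<open>\<alpha>\<close> also for negative \<open>u\<close>.\<close>

definition drift_primitive :: "(real \<Rightarrow> real) \<Rightarrow> real \<Rightarrow> real" where
  "drift_primitive \<alpha> u = (LBINT y=0..ereal u. \<alpha> y)"

definition end_weight :: "(real \<Rightarrow> real) \<Rightarrow> real \<Rightarrow> real \<Rightarrow> real" where
  "end_weight \<alpha> T u = exp (drift_primitive \<alpha> u - u\<^sup>2 / (2 * T))"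

definition end_density :: "(real \<Rightarrow> real) \<Rightarrow> real \<Rightarrow> real \<Rightarrow> real" where
  "end_density \<alpha> T u = end_weight \<alpha> T u / (LBINT v. end_weight \<alpha> T v)"

definition phi :: "(real \<Rightarrow> real) \<Rightarrow> real \<Rightarrow> real \<Rightarrow> real" where
  "phi \<alpha> k1 u = 1/2 * (\<alpha> u)\<^sup>2 + 1/2 * deriv \<alpha> u - k1"

text \<open>The law of the Brownian bridge on \<open>[0,T]\<close> from \<open>0\<close> to \<open>x\<close>, as the law of
  \<open>t \<mapsto> B\<^sub>t - (t/T) B\<^sub>T + (t/T) x\<close> under Wiener measure.\<close>

definition bridge_law :: "real \<Rightarrow> (real \<Rightarrow> real) measure \<Rightarrow> real \<Rightarrow> (real \<Rightarrow> real) measure" where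
  "bridge_law T \<W> x =
     distr \<W> (path_space {0..T}) (\<lambda>\<omega>. \<lambda>t\<in>{0..T}. \<omega> t - t / T * \<omega> T + t / T * x)"

definition biased_brownian_law ::
    "(real \<Rightarrow> real) \<Rightarrow> real \<Rightarrow> (real \<Rightarrow> real) measure \<Rightarrow> (real \<Rightarrow> real) measure" where
  "biased_brownian_law \<alpha> T \<W> =
     density lborel (\<lambda>u. ennreal (end_density \<alpha> T u)) \<bind> bridge_law T \<W>"

lemma measurable_path_space:
  assumes "f \<in> N \<rightarrow>\<^sub>M Pi\<^sub>M I (\<lambda>_. borel)" and "\<And>x. x \<in> space N \<Longrightarrow> continuous_on I (f x)"
  shows "f \<in> N \<rightarrow>\<^sub>M path_space I"
  unfolding path_space_def using assms by (intro measurable_restrict_space2) auto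

lemma measurable_bridge_law:
  assumes "wiener_measure T \<W>" "0 < T"
  shows "bridge_law T \<W> \<in> lborel \<rightarrow>\<^sub>M subprob_algebra (path_space {0..T})"
proof -
  have sW: "sets \<W> = sets (path_space {0..T})" and pW: "prob_space \<W>"
    using assms(1) by (auto simp: wiener_measure_def brownian_motion_on_def)
  have coord: "(\<lambda>\<omega>. \<omega> t) \<in> borel_measurable (path_space {0..T})" if "t \<in> {0..T}" for t
    unfolding path_space_def
    by (intro measurable_restrict_space1 measurable_component_singleton that)
  have cont: "continuous_on {0..T} \<omega>" if "\<omega> \<in> space (path_space {0..T})" for \<omega>
    using that by (auto simp: path_space_def space_restrict_space)
  have "(\<lambda>(x, \<omega>). \<lambda>t\<in>{0..T}. \<omega> t - t / T * \<omega> T + t / T * x)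
      \<in> (lborel :: real measure) \<Otimes>\<^sub>M path_space {0..T} \<rightarrow>\<^sub>M path_space {0..T}"
  proof (rule measurable_path_space)
    show "(\<lambda>(x, \<omega>). \<lambda>t\<in>{0..T}. \<omega> t - t / T * \<omega> T + t / T * x)
      \<in> (lborel :: real measure) \<Otimes>\<^sub>M path_space {0..T} \<rightarrow>\<^sub>M Pi\<^sub>M {0..T} (\<lambda>_. borel)"
      unfolding case_prod_beta
    proof (rule measurable_restrict)
      fix t assume t: "t \<in> {0..T}"
      have T: "T \<in> {0..T}" using assms(2) by simp
      note [measurable] = measurable_compose[OF measurable_snd coord[OF t]]
        measurable_compose[OF measurable_snd coord[OF T]]
      show "(\<lambda>p. snd p t - t / T * snd p T + t / T * fst p)
        \<in> borel_measurable ((lborel :: real measure) \<Otimes>\<^sub>M path_space {0..T})"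
        by measurable
    qed
    fix p assume "p \<in> space ((lborel :: real measure) \<Otimes>\<^sub>M path_space {0..T})"
    then have "snd p \<in> space (path_space {0..T})"
      by (auto simp: space_pair_measure)
    then have "continuous_on {0..T} (\<lambda>t. snd p t - t / T * snd p T + t / T * fst p)"
      using assms(2) by (intro continuous_intros cont) auto
    then show "continuous_on {0..T}
        ((\<lambda>(x, \<omega>). \<lambda>t\<in>{0..T}. \<omega> t - t / T * \<omega> T + t / T * x) p)"
      by (rule continuous_on_eq) (simp add: case_prod_beta)
  qed
  then have "(\<lambda>x. distr \<W> (path_space {0..T}) (\<lambda>\<omega>. \<lambda>t\<in>{0..T}. \<omega> t - t / T * \<omega> T + t / T * x))
      \<in> lborel \<rightarrow>\<^sub>M subprob_algebra (path_space {0..T})"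
  proof (rule measurable_distr2)
    show "(\<lambda>x. \<W>) \<in> (lborel :: real measure) \<rightarrow>\<^sub>M subprob_algebra (path_space {0..T})"
      using pW sW by (intro measurable_const)
        (simp add: space_subprob_algebra prob_space_imp_subprob_space)
  qed
  then show ?thesis
    by (simp add: bridge_law_def[abs_def])
qed

section \<open>The events\<close>

definition Gamma_event ::
    "'a measure \<Rightarrow> (real \<Rightarrow> real) \<Rightarrow> ('a \<Rightarrow> real \<Rightarrow> real) \<Rightarrow> (nat \<Rightarrow> 'a \<Rightarrow> real) \<Rightarrow> (nat \<Rightarrow> 'a \<Rightarrow> real) \<Rightarrow>
      ('a \<Rightarrow> real) \<Rightarrow> nat \<Rightarrow> 'a set" where
  "Gamma_event M f \<omega> V W U n =
     (if n = 0 then space M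
      else {x \<in> space M. (\<forall>i\<in>{1..n}. f (\<omega> x (V i x)) \<ge> W i x) \<and> U x \<le> 1 / fact n})"

text \<open>The alternating unions; see \<open>E_event_odd\<close> and \<open>E_event_even\<close>. The value at \<open>0\<close> is irrelevant.\<close>

definition E_event :: "(nat \<Rightarrow> 'a set) \<Rightarrow> nat \<Rightarrow> 'a set" where
  "E_event \<Gamma> m =
     (\<Union>k\<in>{k. 2 * k + 1 \<le> m}. \<Gamma> (2 * k) - \<Gamma> (2 * k + 1)) \<union> (if even m then \<Gamma> m else {})"

lemma E_event_odd: "E_event \<Gamma> (2 * n + 1) = (\<Union>k\<le>n. \<Gamma> (2 * k) - \<Gamma> (2 * k + 1))"
  by (auto simp: E_event_def)

lemma E_event_even: "E_event \<Gamma> (2 * n + 2) = (\<Union>k\<le>n. \<Gamma> (2 * k) - \<Gamma> (2 * k + 1)) \<union> \<Gamma> (2 * n + 2)"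
proof -
  have "{k. 2 * k + 1 \<le> 2 * n + 2} = {..n}"
    by auto
  then show ?thesis
    by (simp add: E_event_def)
qed

text \<open>The \<open>\<Gamma>\<close> decrease, so the differences are proper and the unions above are disjoint.\<close>

lemma decseq_Gamma_event: "decseq (Gamma_event M f \<omega> V W U)"
proof (rule decseq_SucI)
  fix n
  have "1 / fact (Suc n) \<le> (1 / fact n :: real)"
    by (intro divide_left_mono fact_mono) (auto intro: fact_mono)
  then show "Gamma_event M f \<omega> V W U (Suc n) \<subseteq> Gamma_event M f \<omega> V W U n"
    unfolding Gamma_event_def by (auto intro: order_trans simp del: fact_Suc)
qed

lemma disjoint_layers:
  fixes \<Gamma> :: "nat \<Rightarrow> 'a set"
  assumes "decseq \<Gamma>"
  shows "disjoint_family (\<lambda>k. \<Gamma> (2 * k) - \<Gamma> (2 * k + 1))"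
    and "(\<Union>k\<le>n. \<Gamma> (2 * k) - \<Gamma> (2 * k + 1)) \<inter> \<Gamma> (2 * n + 2) = {}"
proof -
  have sub: "\<Gamma> j \<subseteq> \<Gamma> i" if "i \<le> j" for i j
    using assms that by (simp add: decseq_def)
  have *: "(\<Gamma> (2 * i) - \<Gamma> (2 * i + 1)) \<inter> \<Gamma> j = {}" if "2 * i < j" for i j
    using sub[of "2 * i + 1" j] that by auto
  show "disjoint_family (\<lambda>k. \<Gamma> (2 * k) - \<Gamma> (2 * k + 1))"
    unfolding disjoint_family_on_def
  proof (intro ballI impI)
    fix i k :: nat assume "i \<noteq> k"
    then consider "2 * i < 2 * k" | "2 * k < 2 * i" by linarith
    then show "(\<Gamma> (2 * i) - \<Gamma> (2 * i + 1)) \<inter> (\<Gamma> (2 * k) - \<Gamma> (2 * k + 1)) = {}"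
      by cases (use *[of i "2 * k"] *[of k "2 * i"] in auto)
  qed
  show "(\<Union>k\<le>n. \<Gamma> (2 * k) - \<Gamma> (2 * k + 1)) \<inter> \<Gamma> (2 * n + 2) = {}"
  proof -
    have "(\<Gamma> (2 * k) - \<Gamma> (2 * k + 1)) \<inter> \<Gamma> (2 * n + 2) = {}" if "k \<le> n" for k
      using that by (intro *) simp
    then show ?thesis by blast
  qed
qed

end

theory Submission
  imports Defs
begin

text \<open>
  The idea is to toss a coin of unknown bias \<open>exp (- p)\<close>, with \<open>p = \<integral>\<^sub>0\<^sup>T \<phi> (\<omega> t) dt\<close>, by looking at the
  path \<open>\<omega>\<close> only at finitely many random times. Fix the path. A uniform point \<open>(V, W)\<close> of the
  rectangle \<open>(0,T) \<times> (0,1/T)\<close>, which has area \<open>1\<close>, lies below the graph of \<open>t \<mapsto> \<phi> (\<omega> t)\<close> with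
  probability equal to the area below that graph, which is \<open>p\<close> (\<open>measure_below_graph\<close>); this uses
  \<open>0 \<le> \<phi> \<le> 1/T\<close>. By independence, the first \<open>n\<close> points all lie below the graph with probability
  \<open>p\<^sup>n\<close>, and the event \<open>U \<le> 1/n!\<close> contributes the factor \<open>1/n!\<close>. So \<open>\<Gamma>\<^sub>n\<close> has conditional
  probability \<open>p\<^sup>n/n!\<close> given the path (\<open>prob_Gamma\<close>).

  Since the \<open>\<Gamma>\<^sub>n\<close> decrease, the event \<open>E\<^sub>m\<close> has as conditional probability the partial sum of
  \<open>\<Sum>\<^sub>n (-p)\<^sup>n/n!\<close> up to the index \<open>m\<close>. The odd partial sums belong to the increasing events, hence
  their union \<open>E\<close> has conditional probability \<open>exp (- p)\<close> by dominated convergence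
  (\<open>real_cond_exp_alternating_layers\<close>). A point in all even events but in no odd one lies in every
  \<open>\<Gamma>\<^sub>2\<^sub>n\<^sub>+\<^sub>2\<close>, hence forces \<open>U \<le> 1/(2n+2)!\<close> for all \<open>n\<close>; this has probability \<open>0\<close>.

  Freezing the path is an application of Fubini's theorem, for which \<open>\<phi>\<close> must be Borel
  (\<open>borel_measurable_phi\<close>) and \<open>(\<omega>, t) \<mapsto> \<omega> t\<close> jointly measurable in the path and the time
  (\<open>measurable_path_evaluation\<close>). The locale \<open>thinned_path\<close> collects the path, the points and the
  coin, with \<open>f\<close> in the role of \<open>\<phi>\<close> and \<open>rate (\<omega> x)\<close> in that of \<open>p\<close>.
\<close>

section \<open>Measurability of derivatives and of path evaluation\<close>

text \<open>The derivative is the pointwise limit of the difference quotients with step \<open>1/(n+1)\<close>, and these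
  are continuous; the derivative itself need not be.\<close>

lemma borel_measurable_deriv_everywhere:
  fixes f :: "real \<Rightarrow> real"
  assumes "\<And>u. f differentiable (at u)"
  shows "deriv f \<in> borel_measurable borel"
proof (rule borel_measurable_LIMSEQ_real)
  have "continuous_on UNIV f"
    using assms by (simp add: continuous_at_imp_continuous_on differentiable_imp_continuous_within)
  then have [measurable]: "f \<in> borel_measurable borel"
    by (rule borel_measurable_continuous_onI)
  show "(\<lambda>u. (f (u + inverse (real (Suc n))) - f u) / inverse (real (Suc n))) \<in> borel_measurable borel" for n
    by measurable
  fix u
  have "(f has_real_derivative deriv f u) (at u)"
    using assms[of u] by (simp add: DERIV_deriv_iff_real_differentiable)
  then have "((\<lambda>h. (f (u + h) - f u) / h) \<longlongrightarrow> deriv f u) (at 0)"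
    by (simp add: DERIV_def)
  moreover have "filterlim (\<lambda>n. inverse (real (Suc n))) (at 0) sequentially"
    by (simp add: filterlim_at LIMSEQ_inverse_real_of_nat del: of_nat_Suc)
  ultimately show "(\<lambda>n. (f (u + inverse (real (Suc n))) - f u) / inverse (real (Suc n))) \<longlonglongrightarrow> deriv f u"
    by (rule filterlim_compose)
qed

lemma borel_measurable_phi:
  assumes "\<And>u. \<alpha> differentiable (at u)"
  shows "phi \<alpha> k1 \<in> borel_measurable borel"
proof -
  have "continuous_on UNIV \<alpha>"
    using assms by (simp add: continuous_at_imp_continuous_on differentiable_imp_continuous_within)
  then have [measurable]: "\<alpha> \<in> borel_measurable borel"
    by (rule borel_measurable_continuous_onI)
  note [measurable] = borel_measurable_deriv_everywhere[OF assms]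
  show ?thesis
    unfolding phi_def[abs_def] by measurable
qed

text \<open>The \<open>\<sigma>\<close>-algebra on paths is generated by evaluations at fixed times, so evaluation at a time
  taken from a countable grid is jointly measurable. Continuity of the paths makes evaluation the
  limit of evaluations at the grid points next to \<open>t\<close>. Outside \<open>{a..b}\<close> a path has the constant
  value \<open>undefined\<close>, which is why \<open>t\<close> may range over all reals.\<close>

lemma measurable_path_evaluation:
  assumes ab: "a \<le> b"
  shows "(\<lambda>(p, t). p t) \<in> borel_measurable (path_space {a..b} \<Otimes>\<^sub>M borel)"
proof -
  let ?N = "path_space {a..b} \<Otimes>\<^sub>M (borel :: real measure)"
  have coord [measurable]: "(\<lambda>p. p t) \<in> borel_measurable (path_space {a..b})" if "t \<in> {a..b}" for t
    unfolding path_space_def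
    by (intro measurable_restrict_space1 measurable_component_singleton that)
  \<comment> \<open>The clamping keeps grid points inside the time interval: the floor may fall just below \<open>a\<close>.\<close>
  define grid where "grid n k = max a (min b (real_of_int k / real (Suc n)))" for n k
  have grid_in: "grid n k \<in> {a..b}" for n k
    using ab by (auto simp: grid_def)
  have grid_lim: "(\<lambda>n. grid n \<lfloor>real (Suc n) * t\<rfloor>) \<longlonglongrightarrow> t" if t: "t \<in> {a..b}" for t
  proof -
    have "(\<lambda>n. real_of_int \<lfloor>real (Suc n) * t\<rfloor> / real (Suc n)) \<longlonglongrightarrow> t"
    proof (rule tendsto_sandwich)
      show "(\<lambda>n. t - inverse (real (Suc n))) \<longlonglongrightarrow> t"
        using tendsto_diff[OF tendsto_const[of t] LIMSEQ_inverse_real_of_nat] by simp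
      show "\<forall>\<^sub>F n in sequentially. t - inverse (real (Suc n)) \<le> real_of_int \<lfloor>real (Suc n) * t\<rfloor> / real (Suc n)"
      proof (intro always_eventually allI)
        fix n
        have "real (Suc n) * t - 1 \<le> real_of_int \<lfloor>real (Suc n) * t\<rfloor>"
          by linarith
        then have "(real (Suc n) * t - 1) / real (Suc n) \<le> real_of_int \<lfloor>real (Suc n) * t\<rfloor> / real (Suc n)"
          by (rule divide_right_mono) simp
        then show "t - inverse (real (Suc n)) \<le> real_of_int \<lfloor>real (Suc n) * t\<rfloor> / real (Suc n)"
          by (simp add: diff_divide_distrib divide_inverse[of 1] del: of_nat_Suc)
      qed
      show "\<forall>\<^sub>F n in sequentially. real_of_int \<lfloor>real (Suc n) * t\<rfloor> / real (Suc n) \<le> t"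
      proof (intro always_eventually allI)
        fix n
        have "real_of_int \<lfloor>real (Suc n) * t\<rfloor> \<le> real (Suc n) * t"
          by linarith
        then show "real_of_int \<lfloor>real (Suc n) * t\<rfloor> / real (Suc n) \<le> t"
          by (simp add: pos_divide_le_eq mult.commute del: of_nat_Suc)
      qed
    qed (rule tendsto_const)
    then have "(\<lambda>n. grid n \<lfloor>real (Suc n) * t\<rfloor>) \<longlonglongrightarrow> max a (min b t)"
      unfolding grid_def by (intro tendsto_max tendsto_min tendsto_const)
    then show ?thesis
      using t by simp
  qed
  have step: "(\<lambda>q. fst q (grid n \<lfloor>real (Suc n) * snd q\<rfloor>)) \<in> borel_measurable ?N" for n
  proof (rule measurable_compose_countable'[where I = UNIV and f = "\<lambda>k q. fst q (grid n k)"])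
    show "(\<lambda>q. fst q (grid n k)) \<in> borel_measurable ?N" for k
      by (rule measurable_compose[OF measurable_fst coord[OF grid_in]])
    have "snd \<in> borel_measurable ?N" by (rule measurable_snd)
    then show "(\<lambda>q. \<lfloor>real (Suc n) * snd q\<rfloor>) \<in> measurable ?N (count_space UNIV)"
      by measurable
  qed simp
  have "(\<lambda>q. if snd q \<in> {a..b} then fst q (snd q) else undefined) \<in> borel_measurable ?N"
  proof (rule borel_measurable_LIMSEQ_real)
    show "(\<lambda>q. if snd q \<in> {a..b} then fst q (grid n \<lfloor>real (Suc n) * snd q\<rfloor>) else undefined)
        \<in> borel_measurable ?N" for n
      by (intro measurable_If step) measurable
    fix q assume "q \<in> space ?N"
    then have "continuous_on {a..b} (fst q)"
      by (auto simp: space_pair_measure path_space_def space_restrict_space)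
    then have "(\<lambda>n. fst q (grid n \<lfloor>real (Suc n) * snd q\<rfloor>)) \<longlonglongrightarrow> fst q (snd q)" if "snd q \<in> {a..b}"
      using grid_lim[OF that] that grid_in
      by (rule continuous_on_tendsto_compose[OF _ _ _ always_eventually[OF allI]])
    then show "(\<lambda>n. if snd q \<in> {a..b} then fst q (grid n \<lfloor>real (Suc n) * snd q\<rfloor>) else undefined)
        \<longlonglongrightarrow> (if snd q \<in> {a..b} then fst q (snd q) else undefined)"
      by (cases "snd q \<in> {a..b}") (simp_all only: if_True if_False tendsto_const)
  qed
  also have "?this \<longleftrightarrow> ?thesis"
    unfolding case_prod_beta
    by (intro measurable_cong)
      (auto simp: space_pair_measure path_space_def space_restrict_space space_PiM PiE_def extensional_def)
  finally show ?thesis .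
qed

section \<open>Uniform points below a graph, and conditioning on an independent variable\<close>

lemma below_graph_borel:
  fixes g :: "real \<Rightarrow> real"
  assumes [measurable]: "g \<in> borel_measurable borel"
  shows "{(v, w). w \<le> g v} \<in> sets borel"
proof -
  have "{q \<in> space (borel \<Otimes>\<^sub>M borel). snd q \<le> g (fst q)} \<in> sets (borel \<Otimes>\<^sub>M (borel :: real measure))"
    by measurable
  also have "{q \<in> space (borel \<Otimes>\<^sub>M (borel :: real measure)). snd q \<le> g (fst q)} = {(v, w). w \<le> g v}"
    by (auto simp: space_pair_measure)
  finally show ?thesis
    unfolding borel_prod .
qed

text \<open>The rectangle has area \<open>1\<close>, so its uniform distribution is plain area, and the vertical slice of
  the region at \<open>v\<close> is an interval of length \<open>g v\<close>.\<close>

lemma measure_below_graph: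
  fixes g :: "real \<Rightarrow> real"
  assumes T: "0 < T" and [measurable]: "g \<in> borel_measurable borel"
    and g: "\<And>v. 0 \<le> g v" "\<And>v. g v \<le> 1 / T"
  shows "measure (uniform_measure lborel ({0<..<T} \<times> {0<..<1 / T})) {(v, w). w \<le> g v}
    = (LBINT v:{0..T}. g v)"
proof -
  let ?R = "{0<..<T} \<times> {0<..<1 / T}" and ?S = "{(v, w). w \<le> g v}"
  have S [measurable]: "?S \<in> sets borel"
    by (rule below_graph_borel) fact
  have R: "emeasure lborel ?R = 1"
  proof -
    have "emeasure (lborel \<Otimes>\<^sub>M lborel) ?R = ennreal T * ennreal (1 / T)"
      using T by (subst lborel.emeasure_pair_measure_Times) auto
    then show ?thesis
      using T by (simp add: lborel_prod ennreal_mult[symmetric])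
  qed
  \<comment> \<open>The rectangle is open and the integral is over a closed interval; they differ at the two
    end points, which form a null set.\<close>
  have slice: "emeasure lborel (Pair v -` (?R \<inter> ?S)) = ennreal (indicator {0..T} v *\<^sub>R g v)"
    if "v \<noteq> 0" "v \<noteq> T" for v
  proof (cases "v \<in> {0<..<T}")
    case True
    have "emeasure lborel (Pair v -` (?R \<inter> ?S)) = ennreal (g v)"
    \<comment> \<open>If \<open>g v = 1 / T\<close>, the slice of the open rectangle does not contain its upper end.\<close>
    proof (cases "g v < 1 / T")
      case lt: True
      have "Pair v -` (?R \<inter> ?S) = {0<..g v}"
        using True lt by auto
      then show ?thesis using g by simp
    next
      case False
      then have eq: "g v = 1 / T" using g(2)[of v] by simp
      have "Pair v -` (?R \<inter> ?S) = {0<..<1 / T}"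
        using True eq by auto
      then show ?thesis using T eq by simp
    qed
    then show ?thesis using True by simp
  next
    case False
    then have "Pair v -` (?R \<inter> ?S) = {}" "v \<notin> {0..T}" using that by auto
    then show ?thesis by simp
  qed
  have int: "integrable lborel (\<lambda>v. indicator {0..T} v *\<^sub>R g v)"
  proof (rule integrableI_bounded_set_indicator[where B = "1 / T"])
    show "AE v in lborel. v \<in> {0..T} \<longrightarrow> norm (g v) \<le> 1 / T"
      using g by simp
  qed (use T in auto)
  have "emeasure lborel (?R \<inter> ?S) = emeasure (lborel \<Otimes>\<^sub>M lborel) (?R \<inter> ?S)"
    by (simp add: lborel_prod)
  also have "\<dots> = (\<integral>\<^sup>+v. emeasure lborel (Pair v -` (?R \<inter> ?S)) \<partial>lborel)"
    by (intro lborel.emeasure_pair_measure_alt)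
      (unfold lborel_prod sets_lborel, intro sets.Int S borel_open open_Times open_greaterThanLessThan)
  also have "\<dots> = (\<integral>\<^sup>+v. ennreal (indicator {0..T} v *\<^sub>R g v) \<partial>lborel)"
  proof (rule nn_integral_cong_AE)
    show "AE v in lborel. emeasure lborel (Pair v -` (?R \<inter> ?S)) = ennreal (indicator {0..T} v *\<^sub>R g v)"
      using AE_lborel_singleton[of 0] AE_lborel_singleton[of T] by eventually_elim (rule slice)
  qed
  also have "\<dots> = ennreal (LBINT v:{0..T}. g v)"
    unfolding set_lebesgue_integral_def using g
    by (intro nn_integral_eq_integral int) auto
  finally have "measure lborel (?R \<inter> ?S) = (LBINT v:{0..T}. g v)"
    using g by (simp add: measure_def set_lebesgue_integral_def)
  moreover have "measure lborel ?R = 1"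
    using R by (simp add: measure_def)
  ultimately show ?thesis
    using R by (subst measure_uniform_measure) auto
qed

text \<open>Fubini for independent variables: conditionally on \<open>X\<close>, the variable \<open>Y\<close> keeps its law, so an event
  about the pair may be computed with \<open>X\<close> frozen. Independence is stated for the generated
  \<open>\<sigma>\<close>-algebras because \<open>indep_var\<close> would force \<open>X\<close> and \<open>Y\<close> to have values of the same type.\<close>

lemma (in prob_space) prob_indep_pair:
  assumes X [measurable]: "X \<in> M \<rightarrow>\<^sub>M S" and Y [measurable]: "Y \<in> M \<rightarrow>\<^sub>M R"
    and ind: "indep_set (sets (vimage_algebra (space M) X S)) (sets (vimage_algebra (space M) Y R))"
    and G: "G \<in> sets (S \<Otimes>\<^sub>M R)"
  shows "prob {x \<in> space M. (X x, Y x) \<in> G} = (\<integral>x. prob {y \<in> space M. (X x, Y y) \<in> G} \<partial>M)"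
proof -
  interpret X: prob_space "distr M S X" by (rule prob_space_distr) simp
  interpret Y: prob_space "distr M R Y" by (rule prob_space_distr) simp
  have joint: "distr M (S \<Otimes>\<^sub>M R) (\<lambda>x. (X x, Y x)) = distr M S X \<Otimes>\<^sub>M distr M R Y"
  proof (rule pair_measure_eqI[symmetric])
    fix A B assume A: "A \<in> sets (distr M S X)" and B: "B \<in> sets (distr M R Y)"
    have "prob ((X -` A \<inter> space M) \<inter> (Y -` B \<inter> space M)) = prob (X -` A \<inter> space M) * prob (Y -` B \<inter> space M)"
      by (rule indep_setD[OF ind]) (use A B in \<open>auto intro: in_vimage_algebra\<close>)
    moreover have "(\<lambda>x. (X x, Y x)) -` (A \<times> B) \<inter> space M = (X -` A \<inter> space M) \<inter> (Y -` B \<inter> space M)"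
      by auto
    ultimately show "emeasure (distr M S X) A * emeasure (distr M R Y) B
        = emeasure (distr M (S \<Otimes>\<^sub>M R) (\<lambda>x. (X x, Y x))) (A \<times> B)"
      using A B by (simp add: emeasure_distr emeasure_eq_measure ennreal_mult[symmetric])
  qed (simp_all add: X.sigma_finite_measure_axioms Y.sigma_finite_measure_axioms cong: sets_pair_measure_cong)
  have slice: "emeasure (distr M R Y) (Pair b -` G) = ennreal (prob {y \<in> space M. (b, Y y) \<in> G})" for b
  proof -
    have "Pair b -` G \<in> sets R" using G by (rule sets_Pair1)
    then have "emeasure (distr M R Y) (Pair b -` G) = emeasure M {y \<in> space M. (b, Y y) \<in> G}"
      by (subst emeasure_distr) (auto intro!: arg_cong[where f = "emeasure M"])
    then show ?thesis by (simp add: emeasure_eq_measure)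
  qed
  have "(\<lambda>b. emeasure (distr M R Y) (Pair b -` G)) \<in> borel_measurable S"
    by (rule Y.measurable_emeasure_Pair) (use G in \<open>simp cong: sets_pair_measure_cong\<close>)
  then have "(\<lambda>b. enn2real (ennreal (prob {y \<in> space M. (b, Y y) \<in> G}))) \<in> borel_measurable S"
    unfolding slice by measurable
  then have [measurable]: "(\<lambda>b. prob {y \<in> space M. (b, Y y) \<in> G}) \<in> borel_measurable S"
    by simp
  have "ennreal (prob {x \<in> space M. (X x, Y x) \<in> G}) = emeasure (distr M (S \<Otimes>\<^sub>M R) (\<lambda>x. (X x, Y x))) G"
    using G by (subst emeasure_distr)
      (auto simp: emeasure_eq_measure intro!: arg_cong[where f = prob])
  also have "\<dots> = (\<integral>\<^sup>+b. emeasure (distr M R Y) (Pair b -` G) \<partial>distr M S X)"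
    unfolding joint by (rule Y.emeasure_pair_measure_alt) (use G in \<open>simp cong: sets_pair_measure_cong\<close>)
  also have "\<dots> = (\<integral>\<^sup>+x. ennreal (prob {y \<in> space M. (X x, Y y) \<in> G}) \<partial>M)"
    unfolding slice by (rule nn_integral_distr) auto
  also have "\<dots> = ennreal (\<integral>x. prob {y \<in> space M. (X x, Y y) \<in> G} \<partial>M)"
    by (intro nn_integral_eq_integral integrable_const_bound[where B = 1]) auto
  finally show "prob {x \<in> space M. (X x, Y x) \<in> G} = (\<integral>x. prob {y \<in> space M. (X x, Y y) \<in> G} \<partial>M)"
    by simp
qed

section \<open>Alternating unions of a decreasing sequence of events\<close>

lemma E_event_odd_Suc:
  "E_event \<Gamma> (2 * Suc n + 1) = E_event \<Gamma> (2 * n + 1) \<union> (\<Gamma> (2 * n + 2) - \<Gamma> (2 * n + 3))"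
  unfolding E_event_odd by (auto simp: atMost_Suc numeral_3_eq_3)

lemma incseq_E_event_odd: "incseq (\<lambda>n. E_event \<Gamma> (2 * n + 1))"
  unfolding E_event_odd by (intro monoI UN_mono) auto

lemma E_event_even_eq: "E_event \<Gamma> (2 * n + 2) = E_event \<Gamma> (2 * n + 1) \<union> \<Gamma> (2 * n + 2)"
  by (simp only: E_event_even E_event_odd)

lemma decseq_E_event_even:
  assumes "decseq \<Gamma>"
  shows "decseq (\<lambda>n. E_event \<Gamma> (2 * n + 2))"
proof (rule decseq_SucI)
  fix n
  have "\<Gamma> (2 * Suc n + 2) \<subseteq> \<Gamma> (2 * n + 2)"
    using assms by (rule decseqD) simp
  then show "E_event \<Gamma> (2 * Suc n + 2) \<subseteq> E_event \<Gamma> (2 * n + 2)"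
    unfolding E_event_even_eq E_event_odd_Suc by auto
qed

lemma E_event_odd_subset_even:
  assumes "decseq \<Gamma>"
  shows "E_event \<Gamma> (2 * k + 1) \<subseteq> E_event \<Gamma> (2 * l + 2)"
proof -
  have "E_event \<Gamma> (2 * k + 1) \<subseteq> E_event \<Gamma> (2 * max k l + 1)"
    using incseq_E_event_odd by (rule incseqD) simp
  also have "\<dots> \<subseteq> E_event \<Gamma> (2 * max k l + 2)"
    unfolding E_event_even_eq by auto
  also have "\<dots> \<subseteq> E_event \<Gamma> (2 * l + 2)"
    using decseq_E_event_even[OF assms] by (rule decseqD) simp
  finally show ?thesis .
qed

lemma sum_consecutive_differences:
  fixes a :: "nat \<Rightarrow> 'b :: ring_1"
  shows "(\<Sum>k\<le>n. a (2 * k) - a (2 * k + 1)) = (\<Sum>j<2 * n + 2. (- 1) ^ j * a j)"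
proof (induction n)
  case 0
  show ?case by (simp add: numeral_2_eq_2)
next
  case (Suc n)
  have 1: "{..<2 * Suc n + 2} = insert (2 * Suc n + 1) (insert (2 * Suc n) {..<2 * n + 2})"
    by auto
  have "(\<Sum>j<2 * Suc n + 2. (- 1) ^ j * a j) =
     (- 1) ^ (2 * Suc n + 1) * a (2 * Suc n + 1) + ((- 1) ^ (2 * Suc n) * a (2 * Suc n) + (\<Sum>j<2 * n + 2. (- 1) ^ j * a j))"
    unfolding 1 by (subst sum.insert; simp)+
  then show ?case
    using Suc by simp
qed

text \<open>The layers of the union are disjoint, and each contributes the difference of two consecutive
  measures.\<close>

lemma (in finite_measure) measure_E_event_odd:
  assumes dec: "decseq \<Gamma>" and \<Gamma>: "\<And>n. \<Gamma> n \<in> sets M" and A: "A \<in> sets M"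
  shows "measure M (A \<inter> E_event \<Gamma> (2 * n + 1)) = (\<Sum>j<2 * n + 2. (- 1) ^ j * measure M (A \<inter> \<Gamma> j))"
proof -
  have layer: "measure M (A \<inter> (\<Gamma> j - \<Gamma> (Suc j))) = measure M (A \<inter> \<Gamma> j) - measure M (A \<inter> \<Gamma> (Suc j))" for j
  proof -
    have "A \<inter> (\<Gamma> j - \<Gamma> (Suc j)) = (A \<inter> \<Gamma> j) - (A \<inter> \<Gamma> (Suc j))" by auto
    moreover have "A \<inter> \<Gamma> (Suc j) \<subseteq> A \<inter> \<Gamma> j"
      using decseqD[OF dec, of j "Suc j"] by auto
    ultimately show ?thesis
      using finite_measure_Diff[of "A \<inter> \<Gamma> j" "A \<inter> \<Gamma> (Suc j)"] \<Gamma> A by simp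
  qed
  have "A \<inter> E_event \<Gamma> (2 * n + 1) = (\<Union>k\<in>{..n}. A \<inter> (\<Gamma> (2 * k) - \<Gamma> (2 * k + 1)))"
    unfolding E_event_odd by auto
  also have "measure M \<dots> = (\<Sum>k\<le>n. measure M (A \<inter> (\<Gamma> (2 * k) - \<Gamma> (2 * k + 1))))"
  proof (rule finite_measure_finite_Union)
    show "disjoint_family_on (\<lambda>k. A \<inter> (\<Gamma> (2 * k) - \<Gamma> (2 * k + 1))) {..n}"
      using disjoint_layers(1)[OF dec] unfolding disjoint_family_on_def by blast
  qed (use \<Gamma> A in auto)
  also have "\<dots> = (\<Sum>k\<le>n. measure M (A \<inter> \<Gamma> (2 * k)) - measure M (A \<inter> \<Gamma> (2 * k + 1)))"
    using layer by simp
  also have "\<dots> = (\<Sum>j<2 * n + 2. (- 1) ^ j * measure M (A \<inter> \<Gamma> j))"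
    by (rule sum_consecutive_differences)
  finally show ?thesis .
qed

text \<open>If \<open>\<Gamma>\<^sub>n\<close> has conditional probability \<open>p\<^sup>n/n!\<close>, then that of \<open>E\<^sub>2\<^sub>n\<^sub>+\<^sub>1\<close> is a partial sum of the
  exponential series at \<open>- p\<close>. These events increase, so on each set of the conditioning
  \<open>\<sigma>\<close>-algebra both continuity of the measure and dominated convergence apply; the dominating
  constant is \<open>exp c\<close>.\<close>

lemma (in prob_space) real_cond_exp_alternating_layers:
  fixes \<Gamma> :: "nat \<Rightarrow> 'a set" and p :: "'a \<Rightarrow> real"
  assumes F: "subalgebra M F"
    and dec: "decseq \<Gamma>" and \<Gamma>: "\<And>n. \<Gamma> n \<in> events"
    and p: "p \<in> borel_measurable F" and bound: "\<And>x. \<bar>p x\<bar> \<le> c"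
    and prob_\<Gamma>: "\<And>A n. A \<in> sets F \<Longrightarrow> prob (A \<inter> \<Gamma> n) = (\<integral>x\<in>A. p x ^ n / fact n \<partial>M)"
  shows "AE x in M. real_cond_exp M F (indicator (\<Union>n. E_event \<Gamma> (2 * n + 1))) x = exp (- p x)"
proof -
  interpret fin: finite_measure_subalgebra M F
    by unfold_locales (rule F)
  note [measurable] = \<Gamma> measurable_from_subalg[OF F p]
  have E_meas [measurable]: "E_event \<Gamma> (2 * n + 1) \<in> events" for n
    unfolding E_event_odd by auto
  let ?E = "\<Union>n. E_event \<Gamma> (2 * n + 1)"
  have [measurable]: "?E \<in> events"
    using E_meas by blast
  have c: "0 \<le> c" using bound[of undefined] by linarith
  show ?thesis
  proof (rule fin.real_cond_exp_charact)
    show "(\<lambda>x. exp (- p x)) \<in> borel_measurable F"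
      using p by measurable
    show "integrable M (indicator ?E :: 'a \<Rightarrow> real)"
      by (intro integrable_real_indicator) (simp_all add: emeasure_eq_measure del: One_nat_def add_Suc_right)
    show "integrable M (\<lambda>x. exp (- p x))"
    proof (rule integrable_const_bound[where B = "exp c"])
      show "AE x in M. norm (exp (- p x)) \<le> exp c"
        using bound by (auto simp: abs_le_iff)
    qed measurable
    fix A assume AF: "A \<in> sets F"
    then have A [measurable]: "A \<in> events"
      using F by (auto simp: subalgebra_def)
    define s where "s m x = (\<Sum>j<m. (- p x) ^ j / fact j)" for m x
    have [measurable]: "s m \<in> borel_measurable M" for m
      unfolding s_def by measurable
    have s_bound: "\<bar>s m x\<bar> \<le> exp c" for m x
    proof -
      have "\<bar>s m x\<bar> \<le> (\<Sum>j<m. \<bar>p x\<bar> ^ j / fact j)"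
        unfolding s_def by (rule order_trans[OF sum_abs]) (simp add: power_abs)
      also have "\<dots> \<le> (\<Sum>j. \<bar>p x\<bar> ^ j / fact j)"
        using summable_exp[of "\<bar>p x\<bar>"]
        by (intro sum_le_suminf) (auto simp: divide_inverse mult.commute)
      also have "\<dots> = exp \<bar>p x\<bar>"
        by (simp add: exp_def divide_inverse mult.commute)
      also have "\<dots> \<le> exp c" using bound by simp
      finally show ?thesis .
    qed
    have s_lim: "(\<lambda>m. s m x) \<longlonglongrightarrow> exp (- p x)" for x
      using exp_converges[of "- p x"] unfolding sums_def s_def by (simp add: divide_inverse mult.commute)
    have partial: "prob (A \<inter> E_event \<Gamma> (2 * n + 1)) = (\<integral>x. indicator A x * s (2 * n + 2) x \<partial>M)" for n
    proof -
      have int: "integrable M (\<lambda>x. indicator A x * ((- p x) ^ j / fact j))" for j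
      proof (rule integrable_const_bound[where B = "c ^ j / fact j"])
        show "AE x in M. norm (indicator A x * ((- p x) ^ j / fact j)) \<le> c ^ j / fact j"
          using bound c by (auto simp: indicator_def power_abs intro!: divide_right_mono power_mono)
      qed measurable
      have "prob (A \<inter> E_event \<Gamma> (2 * n + 1)) = (\<Sum>j<2 * n + 2. (- 1) ^ j * (\<integral>x\<in>A. p x ^ j / fact j \<partial>M))"
        using measure_E_event_odd[OF dec \<Gamma> A] prob_\<Gamma>[OF AF] by simp
      also have "\<dots> = (\<Sum>j<2 * n + 2. \<integral>x. indicator A x * ((- p x) ^ j / fact j) \<partial>M)"
      proof (rule sum.cong[OF refl])
        fix j
        have "(- 1) ^ j * (\<integral>x\<in>A. p x ^ j / fact j \<partial>M) = (\<integral>x. (- 1) ^ j * (indicator A x *\<^sub>R (p x ^ j / fact j)) \<partial>M)"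
          unfolding set_lebesgue_integral_def by (rule integral_mult_right_zero[symmetric])
        also have "\<dots> = (\<integral>x. indicator A x * ((- p x) ^ j / fact j) \<partial>M)"
          by (intro Bochner_Integration.integral_cong refl) (simp add: power_minus[of "p _"] mult_ac)
        finally show "(- 1) ^ j * (\<integral>x\<in>A. p x ^ j / fact j \<partial>M) = (\<integral>x. indicator A x * ((- p x) ^ j / fact j) \<partial>M)" .
      qed
      also have "\<dots> = (\<integral>x. (\<Sum>j<2 * n + 2. indicator A x * ((- p x) ^ j / fact j)) \<partial>M)"
        using int by (intro Bochner_Integration.integral_sum[symmetric]) auto
      also have "\<dots> = (\<integral>x. indicator A x * s (2 * n + 2) x \<partial>M)"
        by (simp only: s_def sum_distrib_left)
      finally show ?thesis .
    qed
    have "(\<lambda>n. \<integral>x. indicator A x * s (2 * n + 2) x \<partial>M) \<longlonglongrightarrow> (\<integral>x. indicator A x * exp (- p x) \<partial>M)"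
    proof (rule integral_dominated_convergence[where w = "\<lambda>_. exp c"])
      have "(\<lambda>n. s (2 * n + 2) x) \<longlonglongrightarrow> exp (- p x)" for x
        by (rule filterlim_compose[OF s_lim]) (auto intro!: filterlim_subseq strict_monoI)
      then show "AE x in M. (\<lambda>n. indicator A x * s (2 * n + 2) x) \<longlonglongrightarrow> indicator A x * exp (- p x)"
        by (intro AE_I2 tendsto_mult tendsto_const)
      show "AE x in M. norm (indicator A x * s (2 * n + 2) x) \<le> exp c" for n
        using s_bound by (auto simp: indicator_def)
    qed measurable
    then have "(\<lambda>n. prob (A \<inter> E_event \<Gamma> (2 * n + 1))) \<longlonglongrightarrow> (\<integral>x. indicator A x * exp (- p x) \<partial>M)"
      by (simp only: partial)
    moreover have "(\<lambda>n. prob (A \<inter> E_event \<Gamma> (2 * n + 1))) \<longlonglongrightarrow> prob (\<Union>n. A \<inter> E_event \<Gamma> (2 * n + 1))"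
    proof (rule finite_Lim_measure_incseq)
      show "range (\<lambda>n. A \<inter> E_event \<Gamma> (2 * n + 1)) \<subseteq> events"
        using E_meas A by blast
      show "incseq (\<lambda>n. A \<inter> E_event \<Gamma> (2 * n + 1))"
        using incseq_E_event_odd[of \<Gamma>] unfolding incseq_def by blast
    qed
    ultimately have "prob (\<Union>n. A \<inter> E_event \<Gamma> (2 * n + 1)) = (\<integral>x. indicator A x * exp (- p x) \<partial>M)"
      by (rule LIMSEQ_unique[rotated])
    moreover have "(\<integral>x\<in>A. indicator ?E x \<partial>M) = prob (\<Union>n. A \<inter> E_event \<Gamma> (2 * n + 1))"
    proof -
      have "(\<integral>x\<in>A. indicator ?E x \<partial>M) = (\<integral>x. indicator (\<Union>n. A \<inter> E_event \<Gamma> (2 * n + 1)) x \<partial>M)"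
        unfolding set_lebesgue_integral_def
        by (intro Bochner_Integration.integral_cong refl) (auto simp: indicator_def)
      also have "\<dots> = prob (\<Union>n. A \<inter> E_event \<Gamma> (2 * n + 1))"
        by simp (metis (no_types, lifting) A Int_absorb2 UN_least le_infI1 sets.sets_into_space)
      finally show ?thesis .
    qed
    ultimately show "(\<integral>x\<in>A. indicator ?E x \<partial>M) = (\<integral>x\<in>A. exp (- p x) \<partial>M)"
      by (simp add: set_lebesgue_integral_def)
  qed
qed

section \<open>A random path with independent uniform points and an independent uniform coin\<close>

locale thinned_path = prob_space M for M :: "'a measure" +
  fixes T :: real and f :: "real \<Rightarrow> real"
    and \<omega> :: "'a \<Rightarrow> real \<Rightarrow> real" and V W :: "nat \<Rightarrow> 'a \<Rightarrow> real" and U :: "'a \<Rightarrow> real"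
  assumes T: "0 < T"
    and f_borel [measurable]: "f \<in> borel_measurable borel"
    and f_bounds: "\<And>u. 0 \<le> f u" "\<And>u. f u \<le> 1 / T"
    and path [measurable]: "\<omega> \<in> M \<rightarrow>\<^sub>M path_space {0..T}"
    and points: "indep_vars (\<lambda>_. borel) (\<lambda>i x. (V i x, W i x)) {1..}"
    and points_unif: "\<And>i. i \<ge> 1 \<Longrightarrow> distr M lborel (\<lambda>x. (V i x, W i x)) =
         uniform_measure lborel ({0<..<T} \<times> {0<..<1 / T})"
    and U_borel [measurable]: "U \<in> borel_measurable M"
    and U_unif: "distr M lborel U = uniform_measure lborel {0<..<1}"
    and indep: "indep_sets
      (\<lambda>j. [sets (vimage_algebra (space M) \<omega> (path_space {0..T})),
            sets (vimage_algebra (space M) (\<lambda>x. \<lambda>i\<in>{1..}. (V i x, W i x))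
              (Pi\<^sub>M {1..} (\<lambda>_. borel))),
            sets (vimage_algebra (space M) U borel)] ! j) {..<3}"
begin

(* The index set {1..} occurs inside the function space of the point sequence. Keeping it in this form,
   instead of {Suc 0..}, lets facts about that space match after simplification. *)
context
  notes One_nat_def [simp del]
begin

abbreviation "paths \<equiv> path_space {0..T}"
abbreviation "mark_space \<equiv> Pi\<^sub>M {1::nat..} (\<lambda>_. borel :: (real \<times> real) measure)"
abbreviation "marks \<equiv> \<lambda>x. \<lambda>i\<in>{1..}. (V i x, W i x)"
abbreviation "path_algebra \<equiv> vimage_algebra (space M) \<omega> paths"

definition rate :: "(real \<Rightarrow> real) \<Rightarrow> real" where
  "rate b = (LBINT t:{0..T}. f (b t))"

lemma mark_measurable [measurable]: "1 \<le> i \<Longrightarrow> (\<lambda>x. (V i x, W i x)) \<in> borel_measurable M"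
  using points by (auto simp: indep_vars_def2)

lemma marks_measurable [measurable]: "marks \<in> measurable M mark_space"
  by (intro measurable_restrict mark_measurable) simp

lemma path_algebra_subalgebra: "subalgebra M path_algebra"
proof -
  have "\<omega> \<in> space M \<rightarrow> space paths"
    using path by (rule measurable_space[THEN Pi_I])
  then show ?thesis
    using path by (auto simp: subalgebra_def sets_vimage_algebra2)
qed

lemma path_measurable_path_algebra: "\<omega> \<in> path_algebra \<rightarrow>\<^sub>M paths"
  using measurable_space[OF path] by (intro measurable_vimage_algebra1) auto

lemma path_borel: "b \<in> space paths \<Longrightarrow> b \<in> borel_measurable borel"
  using measurable_compose[OF measurable_Pair1' measurable_path_evaluation[of 0 T], of b] T by simp

lemma rate_measurable: "rate \<in> borel_measurable paths"
proof -
  have [measurable]: "(\<lambda>q. fst q (snd q)) \<in> borel_measurable (paths \<Otimes>\<^sub>M borel)"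
    using measurable_path_evaluation[of 0 T] T by (simp add: case_prod_beta)
  have "(\<lambda>q. indicator {0..T} (snd q) *\<^sub>R f (fst q (snd q))) \<in> borel_measurable (paths \<Otimes>\<^sub>M borel)"
    by measurable
  then have "(\<lambda>(b, t). indicator {0..T} t *\<^sub>R f (b t)) \<in> borel_measurable (paths \<Otimes>\<^sub>M lborel)"
    by (simp add: case_prod_beta cong: measurable_cong_sets sets_pair_measure_cong)
  then show ?thesis
    unfolding rate_def set_lebesgue_integral_def by (rule lborel.borel_measurable_lebesgue_integral)
qed

lemma rate_bounds: "0 \<le> rate b" "rate b \<le> 1"
proof -
  show "0 \<le> rate b"
    unfolding rate_def set_lebesgue_integral_def using f_bounds(1)
    by (intro Bochner_Integration.integral_nonneg) simp
  have "rate b \<le> (\<integral>t. indicator {0..T} t *\<^sub>R (1 / T) \<partial>lborel)"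
    unfolding rate_def set_lebesgue_integral_def
  proof (rule integral_mono')
    show "integrable lborel (\<lambda>t. indicator {0..T} t *\<^sub>R (1 / T))"
      using T by simp
  qed (use T f_bounds in \<open>auto simp: indicator_def\<close>)
  also have "\<dots> = 1"
    using T by simp
  finally show "rate b \<le> 1" .
qed

lemma prob_mark_below:
  assumes i: "1 \<le> i" and b: "b \<in> space paths"
  shows "prob {y \<in> space M. W i y \<le> f (b (V i y))} = rate b"
proof -
  note [measurable] = path_borel[OF b] mark_measurable[OF i]
  have S: "{(v, w). w \<le> f (b v)} \<in> sets borel"
    by (rule below_graph_borel) measurable
  have "rate b = measure (distr M lborel (\<lambda>x. (V i x, W i x))) {(v, w). w \<le> f (b v)}"
    unfolding points_unif[OF i] rate_def
    by (rule measure_below_graph[symmetric]) (use T f_bounds in auto)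
  also have "\<dots> = prob {y \<in> space M. W i y \<le> f (b (V i y))}"
    using S by (subst measure_distr) (auto intro!: arg_cong[where f = prob])
  finally show ?thesis by simp
qed

text \<open>This is the conditional probability that the first \<open>n\<close> points all fall below the graph, with the
  path frozen at \<open>b\<close>.\<close>

lemma prob_marks_below:
  assumes b: "b \<in> space paths"
  shows "prob {y \<in> space M. \<forall>i\<in>{1..n}. W i y \<le> f (b (V i y))} = rate b ^ n"
proof (cases "n = 0")
  case True
  then show ?thesis by (simp add: prob_space)
next
  case False
  note [measurable] = path_borel[OF b]
  let ?S = "{(v, w). w \<le> f (b v)}"
  have S: "?S \<in> sets borel"
    by (rule below_graph_borel) measurable
  have "{y \<in> space M. \<forall>i\<in>{1..n}. W i y \<le> f (b (V i y))}
      = (\<Inter>i\<in>{1..n}. (\<lambda>x. (V i x, W i x)) -` ?S \<inter> space M)"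
    using False by auto
  also have "prob \<dots> = (\<Prod>i\<in>{1..n}. prob ((\<lambda>x. (V i x, W i x)) -` ?S \<inter> space M))"
    by (rule indep_varsD[OF points]) (use False S in auto)
  also have "\<dots> = (\<Prod>i\<in>{1..n}. rate b)"
  proof (rule prod.cong[OF refl])
    fix i assume "i \<in> {1..n}"
    moreover have "(\<lambda>x. (V i x, W i x)) -` ?S \<inter> space M = {y \<in> space M. W i y \<le> f (b (V i y))}"
      by auto
    ultimately show "prob ((\<lambda>x. (V i x, W i x)) -` ?S \<inter> space M) = rate b"
      using prob_mark_below[OF _ b] by simp
  qed
  finally show ?thesis by simp
qed

lemma indep_path_marks:
  "indep_set (sets path_algebra) (sets (vimage_algebra (space M) marks mark_space))"
proof (rule indep_setI)
  let ?F = "\<lambda>j::nat. [sets path_algebra, sets (vimage_algebra (space M) marks mark_space),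
    sets (vimage_algebra (space M) U borel)] ! j"
  have ev: "?F j \<subseteq> events" if "j < 3" for j
    using indep that by (auto simp: indep_sets_def)
  show "sets path_algebra \<subseteq> events" "sets (vimage_algebra (space M) marks mark_space) \<subseteq> events"
    using ev[of 0] ev[of 1] by auto
  fix a c
  assume a: "a \<in> sets path_algebra" and c: "c \<in> sets (vimage_algebra (space M) marks mark_space)"
  define A where "A j = (if j = 0 then a else c)" for j :: nat
  have "prob (\<Inter>j\<in>{0, 1}. A j) = (\<Prod>j\<in>{0, 1}. prob (A j))"
    by (rule indep_setsD[OF indep]) (use a c in \<open>auto simp: A_def\<close>)
  then show "prob (a \<inter> c) = prob a * prob c"
    by (simp add: A_def Int_commute)
qed

text \<open>The three \<open>\<sigma>\<close>-algebras are independent, hence so are the one generated by the first two and the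
  third. An event about the pair (path, points) lies in the generated one, because both
  components are measurable with respect to it.\<close>

lemma prob_path_marks_coin:
  assumes S: "S \<in> sets (paths \<Otimes>\<^sub>M mark_space)" and D: "D \<in> sets borel"
  shows "prob {x \<in> space M. (\<omega> x, marks x) \<in> S \<and> U x \<in> D}
    = prob {x \<in> space M. (\<omega> x, marks x) \<in> S} * prob {x \<in> space M. U x \<in> D}"
proof -
  let ?F = "\<lambda>j::nat. [sets path_algebra, sets (vimage_algebra (space M) marks mark_space),
    sets (vimage_algebra (space M) U borel)] ! j"
  \<comment> \<open>Block \<open>0\<close> collects the path and the points, block \<open>1\<close> is the coin.\<close>
  define group where "group j = (if j = 0 then {0, 1} else {2 :: nat})" for j :: nat
  have grouped: "indep_sets (\<lambda>j. sigma_sets (space M) (\<Union>i\<in>group j. ?F i)) {0, 1}"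
  proof (rule indep_sets_collect_sigma)
    have "(\<Union>j\<in>{0, 1}. group j) = {..<3}"
      by (auto simp: group_def)
    then show "indep_sets ?F (\<Union>j\<in>{0, 1}. group j)"
      using indep by simp
    show "Int_stable (?F i)" if "j \<in> {0, 1}" "i \<in> group j" for i j
      using that by (auto simp: group_def sets.Int_stable split: if_splits)
    show "disjoint_family_on group {0, 1}"
      by (auto simp: disjoint_family_on_def group_def)
  qed
  let ?N = "sigma (space M) (?F 0 \<union> ?F 1)"
  have sub: "?F 0 \<union> ?F 1 \<subseteq> Pow (space M)"
    using sets.space_closed[of path_algebra]
      sets.space_closed[of "vimage_algebra (space M) marks mark_space"] by auto
  have "\<omega> \<in> ?N \<rightarrow>\<^sub>M paths"
  proof (rule measurableI)
    show "\<omega> x \<in> space paths" if "x \<in> space ?N" for x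
      using that measurable_space[OF path] sub by (simp add: space_measure_of)
    show "\<omega> -` B \<inter> space ?N \<in> sets ?N" if "B \<in> sets paths" for B
      using in_vimage_algebra[OF that, of \<omega> "space M"] sub
      by (simp add: space_measure_of sets_measure_of sigma_sets.Basic)
  qed
  moreover have "marks \<in> ?N \<rightarrow>\<^sub>M mark_space"
  proof (rule measurableI)
    show "marks x \<in> space mark_space" if "x \<in> space ?N" for x
      using that measurable_space[OF marks_measurable] sub by (simp add: space_measure_of)
    show "marks -` B \<inter> space ?N \<in> sets ?N" if "B \<in> sets mark_space" for B
      using in_vimage_algebra[OF that, of marks "space M"] sub
      by (simp add: space_measure_of sets_measure_of sigma_sets.Basic)
  qed
  ultimately have "(\<lambda>x. (\<omega> x, marks x)) \<in> ?N \<rightarrow>\<^sub>M paths \<Otimes>\<^sub>M mark_space"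
    by (rule measurable_Pair)
  from measurable_sets[OF this S]
  have S': "(\<lambda>x. (\<omega> x, marks x)) -` S \<inter> space M \<in> sigma_sets (space M) (?F 0 \<union> ?F 1)"
    using sub by (simp add: space_measure_of sets_measure_of)
  have D': "U -` D \<inter> space M \<in> sigma_sets (space M) (?F 2)"
    using in_vimage_algebra[OF D, of U "space M"] by (simp add: sigma_sets.Basic)
  define A where "A j = (if j = 0 then (\<lambda>x. (\<omega> x, marks x)) -` S \<inter> space M else U -` D \<inter> space M)"
    for j :: nat
  have "prob (\<Inter>j\<in>{0, 1}. A j) = (\<Prod>j\<in>{0, 1}. prob (A j))"
    by (rule indep_setsD[OF grouped]) (use S' D' in \<open>auto simp: A_def group_def\<close>)
  moreover have "(\<Inter>j\<in>{0, 1}. A j) = {x \<in> space M. (\<omega> x, marks x) \<in> S \<and> U x \<in> D}"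
    "A 0 = {x \<in> space M. (\<omega> x, marks x) \<in> S}" "A 1 = {x \<in> space M. U x \<in> D}"
    by (auto simp: A_def)
  ultimately show ?thesis by simp
qed

lemma prob_coin:
  assumes r: "0 \<le> r" "r \<le> 1"
  shows "prob {x \<in> space M. U x \<le> r} = r"
proof -
  have "measure lborel ({0<..<1} \<inter> {..r}) = r"
  proof (cases "r < 1")
    case True
    then have "{0<..<1} \<inter> {..r} = {0<..r}"
      by auto
    then show ?thesis using r by simp
  next
    case False
    then have "{0<..<1} \<inter> {..r} = {0<..<1}" "r = 1"
      using r by auto
    then show ?thesis by simp
  qed
  then have "measure (distr M lborel U) {..r} = r"
    unfolding U_unif by (subst measure_uniform_measure) auto
  moreover have "prob {x \<in> space M. U x \<le> r} = measure (distr M lborel U) {..r}"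
    by (subst measure_distr) (auto intro!: arg_cong[where f = prob])
  ultimately show ?thesis by simp
qed

text \<open>The first \<open>n\<close> comparisons as a set in the product of path space and point space, where it can be
  sliced at a fixed path.\<close>

definition accept :: "nat \<Rightarrow> ((real \<Rightarrow> real) \<times> (nat \<Rightarrow> real \<times> real)) set" where
  "accept n = {q \<in> space (paths \<Otimes>\<^sub>M mark_space). \<forall>i\<in>{1..n}. snd (snd q i) \<le> f (fst q (fst (snd q i)))}"

lemma accept_measurable [measurable]: "accept n \<in> sets (paths \<Otimes>\<^sub>M mark_space)"
proof -
  have below: "(\<lambda>q. f (fst q (fst (snd q i)))) \<in> borel_measurable (paths \<Otimes>\<^sub>M mark_space)"
    and height: "(\<lambda>q. snd (snd q i)) \<in> borel_measurable (paths \<Otimes>\<^sub>M mark_space)"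
    if i: "i \<in> {1..n}" for i
  proof -
    have "(\<lambda>v. v i) \<in> mark_space \<rightarrow>\<^sub>M borel \<Otimes>\<^sub>M borel"
      unfolding borel_prod by (rule measurable_component_singleton) (use i in simp)
    then have mark [measurable]: "(\<lambda>q. snd q i) \<in> paths \<Otimes>\<^sub>M mark_space \<rightarrow>\<^sub>M borel \<Otimes>\<^sub>M borel"
      by (rule measurable_compose[OF measurable_snd])
    show "(\<lambda>q. snd (snd q i)) \<in> borel_measurable (paths \<Otimes>\<^sub>M mark_space)"
      by measurable
    have "(\<lambda>q. (fst q, fst (snd q i))) \<in> paths \<Otimes>\<^sub>M mark_space \<rightarrow>\<^sub>M paths \<Otimes>\<^sub>M borel"
      by measurable
    from measurable_compose[OF this measurable_path_evaluation]
    have "(\<lambda>q. fst q (fst (snd q i))) \<in> borel_measurable (paths \<Otimes>\<^sub>M mark_space)"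
      using T by simp
    then show "(\<lambda>q. f (fst q (fst (snd q i)))) \<in> borel_measurable (paths \<Otimes>\<^sub>M mark_space)"
      by measurable
  qed
  show ?thesis
    unfolding accept_def
    by (intro sets.sets_Collect_finite_All borel_measurable_le below height) auto
qed

lemma mem_accept:
  "x \<in> space M \<Longrightarrow> y \<in> space M \<Longrightarrow>
    (\<omega> x, marks y) \<in> accept n \<longleftrightarrow> (\<forall>i\<in>{1..n}. W i y \<le> f (\<omega> x (V i y)))"
  using measurable_space[OF path] measurable_space[OF marks_measurable]
  by (auto simp: accept_def space_pair_measure)

abbreviation "\<Gamma> \<equiv> Gamma_event M f \<omega> V W U"

lemma Gamma_eq_accept:
  "0 < n \<Longrightarrow> \<Gamma> n = {x \<in> space M. (\<omega> x, marks x) \<in> accept n \<and> U x \<le> 1 / fact n}"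
  by (auto simp: Gamma_event_def mem_accept)

lemma Gamma_measurable [measurable]: "\<Gamma> n \<in> events"
proof (cases "n = 0")
  case True
  then show ?thesis by (simp add: Gamma_event_def)
next
  case False
  then show ?thesis by (simp add: Gamma_eq_accept)
qed

text \<open>The set \<open>A\<close> is determined by the path. Split off the coin, which gives \<open>1/n!\<close>; then freeze the
  path, which leaves \<open>rate (\<omega> x) ^ n\<close> on \<open>A\<close>.\<close>

lemma prob_Gamma:
  assumes "A \<in> sets path_algebra"
  shows "prob (A \<inter> \<Gamma> n) = (\<integral>x\<in>A. rate (\<omega> x) ^ n / fact n \<partial>M)"
proof -
  have "\<omega> \<in> space M \<rightarrow> space paths"
    using measurable_space[OF path] by auto
  then obtain B where B [measurable]: "B \<in> sets paths" and A: "A = \<omega> -` B \<inter> space M"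
    using assms by (auto simp: sets_vimage_algebra2)
  show ?thesis
  \<comment> \<open>\<open>\<Gamma> 0\<close> is the whole space, without the coin condition \<open>U \<le> 1\<close>.\<close>
  proof (cases "n = 0")
    case True
    have "A \<in> events"
      using assms path_algebra_subalgebra by (auto simp: subalgebra_def)
    then show ?thesis
      using True by (simp add: Gamma_event_def set_lebesgue_integral_def)
  next
    case False
    let ?G = "accept n \<inter> (B \<times> space mark_space)"
    have G: "?G \<in> sets (paths \<Otimes>\<^sub>M mark_space)"
      by measurable
    have "A \<inter> \<Gamma> n = {x \<in> space M. (\<omega> x, marks x) \<in> ?G \<and> U x \<in> {..1 / fact n}}"
      using False measurable_space[OF marks_measurable] by (auto simp: A Gamma_eq_accept)
    also have "prob \<dots> = prob {x \<in> space M. (\<omega> x, marks x) \<in> ?G} * (1 / fact n)"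
      by (subst prob_path_marks_coin[OF G]) (simp_all add: prob_coin fact_ge_1)
    also have "prob {x \<in> space M. (\<omega> x, marks x) \<in> ?G} = (\<integral>x. prob {y \<in> space M. (\<omega> x, marks y) \<in> ?G} \<partial>M)"
      using path marks_measurable indep_path_marks G by (rule prob_indep_pair)
    also have "\<dots> = (\<integral>x. indicator A x * rate (\<omega> x) ^ n \<partial>M)"
    proof (rule Bochner_Integration.integral_cong[OF refl])
      fix x assume x: "x \<in> space M"
      have "{y \<in> space M. (\<omega> x, marks y) \<in> ?G}
          = (if x \<in> A then {y \<in> space M. \<forall>i\<in>{1..n}. W i y \<le> f (\<omega> x (V i y))} else {})"
        using x measurable_space[OF marks_measurable] by (auto simp: A mem_accept)
      then show "prob {y \<in> space M. (\<omega> x, marks y) \<in> ?G} = indicator A x * rate (\<omega> x) ^ n"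
        using prob_marks_below[OF measurable_space[OF path x]] by simp
    qed
    also have "(\<integral>x. indicator A x * rate (\<omega> x) ^ n \<partial>M) * (1 / fact n)
        = (\<integral>x. indicator A x * rate (\<omega> x) ^ n * (1 / fact n) \<partial>M)"
      by (rule integral_mult_left_zero[symmetric])
    finally show ?thesis
      by (simp add: set_lebesgue_integral_def)
  qed
qed

lemma E_event_measurable: "E_event \<Gamma> m \<in> events"
  by (auto simp: E_event_def)

text \<open>The two sequences of events enclose \<open>E\<close> with gap \<open>\<Gamma> (2 * n + 2)\<close> at stage \<open>n\<close>, which the coin alone
  makes improbable.\<close>

lemma prob_E_event_gap:
  "prob ((\<Inter>n. E_event \<Gamma> (2 * n + 2)) - (\<Union>n. E_event \<Gamma> (2 * n + 1))) = 0"
proof -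
  let ?gap = "(\<Inter>n. E_event \<Gamma> (2 * n + 2)) - (\<Union>n. E_event \<Gamma> (2 * n + 1))"
  have "prob ?gap \<le> 1 / fact (2 * n + 2)" for n
  proof -
    have "?gap \<subseteq> \<Gamma> (2 * n + 2)"
      unfolding E_event_even_eq by blast
    also have "\<dots> \<subseteq> {x \<in> space M. U x \<le> 1 / fact (2 * n + 2)}"
      by (auto simp: Gamma_event_def)
    finally have "?gap \<subseteq> {x \<in> space M. U x \<le> 1 / fact (2 * n + 2)}" .
    then have "prob ?gap \<le> prob {x \<in> space M. U x \<le> 1 / fact (2 * n + 2)}"
      by (rule finite_measure_mono) measurable
    also have "\<dots> = 1 / fact (2 * n + 2)"
      by (intro prob_coin) (simp_all add: fact_ge_1 del: fact_Suc)
    finally show ?thesis .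
  qed
  moreover have "(\<lambda>n. 1 / fact (2 * n + 2) :: real) \<longlonglongrightarrow> 0"
  proof -
    have "(\<lambda>m. 1 / fact m :: real) \<longlonglongrightarrow> 0"
      using summable_LIMSEQ_zero[OF summable_exp[of "1 :: real"]] by (simp add: inverse_eq_divide)
    moreover have "filterlim (\<lambda>n :: nat. 2 * n + 2) sequentially sequentially"
      by (intro filterlim_subseq strict_monoI) simp
    ultimately show ?thesis
      by (rule filterlim_compose)
  qed
  ultimately have "prob ?gap \<le> 0"
    by (intro tendsto_lowerbound) auto
  then show ?thesis
    by (simp add: measure_le_0_iff)
qed

lemma real_cond_exp_E_event:
  "AE x in M. real_cond_exp M path_algebra (indicator (\<Union>n. E_event \<Gamma> (2 * n + 1))) x
    = exp (- rate (\<omega> x))"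
proof (rule real_cond_exp_alternating_layers[where c = 1])
  show "(\<lambda>x. rate (\<omega> x)) \<in> borel_measurable path_algebra"
    by (rule measurable_compose[OF path_measurable_path_algebra rate_measurable])
  show "\<bar>rate (\<omega> x)\<bar> \<le> 1" for x
    using rate_bounds by simp
qed (rule path_algebra_subalgebra decseq_Gamma_event Gamma_measurable prob_Gamma; assumption?)+

end

end

section \<open>Exact simulation of the acceptance event\<close>

theorem theorem1:
  fixes \<alpha> :: "real \<Rightarrow> real" and T k1 k2 :: real
    and \<W> :: "(real \<Rightarrow> real) measure"
    and M :: "'a measure"
    and \<omega> :: "'a \<Rightarrow> real \<Rightarrow> real"
    and V W :: "nat \<Rightarrow> 'a \<Rightarrow> real" and U :: "'a \<Rightarrow> real"
  defines "\<phi> \<equiv> phi \<alpha> k1"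
  defines "\<Gamma> \<equiv> Gamma_event M \<phi> \<omega> V W U"
  defines "E \<equiv> E_event \<Gamma>"
  defines "I \<equiv> (indicator (\<Union>n. E (2 * n + 1)) :: 'a \<Rightarrow> real)"
  assumes T: "T > 0"
    and wiener: "wiener_measure T \<W>"
    and sde: "has_weakly_unique_global_solution \<alpha>"
    and novikov: "integrable \<W> (\<lambda>b. exp (1/2 * (LBINT t:{0..T}. (\<alpha> (b t))\<^sup>2)))"
    and diff: "\<And>u. \<alpha> differentiable (at u)"
    and c_finite: "integrable lborel (end_weight \<alpha> T)"
    and bounds: "\<And>u. k1 \<le> 1/2 * (\<alpha> u)\<^sup>2 + 1/2 * deriv \<alpha> u"
      "\<And>u. 1/2 * (\<alpha> u)\<^sup>2 + 1/2 * deriv \<alpha> u \<le> k2"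
    and phi_bounds: "\<And>u. 0 \<le> \<phi> u" "\<And>u. \<phi> u \<le> 1 / T"
    and M: "prob_space M"
    and path: "\<omega> \<in> M \<rightarrow>\<^sub>M path_space {0..T}"
      "distr M (path_space {0..T}) \<omega> = biased_brownian_law \<alpha> T \<W>"
    and points: "prob_space.indep_vars M (\<lambda>_. borel) (\<lambda>i x. (V i x, W i x)) {1..}"
      "\<And>i. i \<ge> 1 \<Longrightarrow> distr M lborel (\<lambda>x. (V i x, W i x)) =
         uniform_measure lborel ({0<..<T} \<times> {0<..<1 / T})"
    and unif: "U \<in> borel_measurable M" "distr M lborel U = uniform_measure lborel {0<..<1}"
    and indep: "prob_space.indep_sets M
      (\<lambda>j. [sets (vimage_algebra (space M) \<omega> (path_space {0..T})),
            sets (vimage_algebra (space M) (\<lambda>x. \<lambda>i\<in>{1..}. (V i x, W i x))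
              (Pi\<^sub>M {1..} (\<lambda>_. borel))),
            sets (vimage_algebra (space M) U borel)] ! j) {..<3}"
  shows "((\<forall>n\<ge>1. E n \<in> sets M) \<and>
          incseq (\<lambda>n. E (2 * n + 1)) \<and>
          decseq (\<lambda>n. E (2 * n + 2)) \<and>
          (\<forall>k l. E (2 * k + 1) \<subseteq> E (2 * l + 2)) \<and>
          measure M ((\<Inter>n. E (2 * n + 2)) - (\<Union>n. E (2 * n + 1))) = 0) \<and>
         (AE x in M.
            real_cond_exp M (vimage_algebra (space M) \<omega> (path_space {0..T}))
              (indicator {x \<in> space M. I x = 1}) x =
            exp (- (LBINT t:{0..T}. \<phi> (\<omega> x t))))"
proof -
  interpret prob_space M by (rule M)
  have [measurable]: "\<phi> \<in> borel_measurable borel"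
    unfolding \<phi>_def by (rule borel_measurable_phi) (rule diff)
  interpret thin: thinned_path M T \<phi> \<omega> V W U
    by unfold_locales (use T phi_bounds path(1) points unif indep in simp_all)
  have dec: "decseq \<Gamma>"
    unfolding \<Gamma>_def by (rule decseq_Gamma_event)
  have E_events: "E n \<in> events" for n
    unfolding E_def \<Gamma>_def by (rule thin.E_event_measurable)
  have "{x \<in> space M. I x = 1} = (\<Union>n. E (2 * n + 1))"
    using sets.sets_into_space[OF E_events] by (auto simp: I_def indicator_def)
  then have "AE x in M. real_cond_exp M (vimage_algebra (space M) \<omega> (path_space {0..T}))
      (indicator {x \<in> space M. I x = 1}) x = exp (- (LBINT t:{0..T}. \<phi> (\<omega> x t)))"
    using thin.real_cond_exp_E_event unfolding E_def \<Gamma>_def thin.rate_def by (simp only:)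
  moreover have "measure M ((\<Inter>n. E (2 * n + 2)) - (\<Union>n. E (2 * n + 1))) = 0"
    unfolding E_def \<Gamma>_def by (rule thin.prob_E_event_gap)
  moreover have "incseq (\<lambda>n. E (2 * n + 1))" "decseq (\<lambda>n. E (2 * n + 2))"
    "E (2 * k + 1) \<subseteq> E (2 * l + 2)" for k l
    unfolding E_def
    by (rule incseq_E_event_odd decseq_E_event_even[OF dec] E_event_odd_subset_even[OF dec])+
  ultimately show ?thesis
    using E_events by blast
qed

end
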